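(* Let $\phi$ be a strictly q-positive functional on $\mathcal{P}_2$, with moments $s_{k,j}=\phi((X_1^k)^+X_1^j)$, $k,j\in\mathbb{N}_0$. For $n\ge0$ and $t\in\mathbb{N}_0$ let $R_n(t)=[s_{k,j}]_{t\le k,j\le t+n}$, and let $F_n(t)$, $J(t)$, $H_n(t)$ be the matrices defined in the context. Then for each $n\ge0$ the family $\{R_n(t)^{-1}\}_{t\in\mathbb{N}_0}$ is the solution of the displacement equation $$R_n(t+1)^{-1}-F_n(t)^*R_n(t)^{-1}F_n(t)=H_n(t)^*J(t)H_n(t),\qquad t\in\mathbb{N}_0.$$
   Context: $\mathbb{N}_0$ is the set of nonnegative integers. $\mathcal{P}_2$ is the algebra of complex polynomials in two noncommuting variables $X_1,X_2$, with the conjugate-linear anti-multiplicative involution $^+$ determined by $X_1^+=X_2$, $X_2^+=X_1$. A linear functional $\phi$ on $\mathcal{P}_2$ is strictly q-positive if $\phi(P^+P)>0$ for every nonzero polynomial $P$ in the single variable $X_1$. Then $K(k,j)=s_{k,j}$ is a strictly positive definite kernel on $\mathbb{N}_0$. **Parameters.** For a complex number $\gamma$ with $|\gamma|<1$ put $J(\gamma)=\begin{bmatrix}\gamma & d\\ d&-\overline\gamma\end{bmatrix}$, $d=(1-|\gamma|^2)^{1/2}$. Given numbers $\{\gamma_{k,j}\}_{0\le k\le j}$ with $\gamma_{k,k}=0$ and $|\gamma_{k,j}|<1$, define matrices $U_{k,j}$ of size $(j-k+1)\times(j-k+1)$ by $U_{k,k}=I_1$ and, for $k<j$, $$U_{k,j}=\big(J(\gamma_{k,k+1})\oplus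 I_{j-k-1}\big)\big(I_1\oplus J(\gamma_{k,k+2})\oplus I_{j-k-2}\big)\cdots\big(I_{j-k-1}\oplus J(\gamma_{k,j})\big)\big(U_{k+1,j}\oplus I_1\big),$$ where $I_p$ is the $p\times p$ identity matrix. It is known that there is a unique such family with $s_{l,m}=s_{l,l}^{1/2}\,(U_{l,m})_{1,1}\,s_{m,m}^{1/2}$ for all $l\le m$ (where $(\cdot)_{1,1}$ is the upper-left entry); it is called the family of parameters of the moment kernel. Put $d_{k,j}=(1-|\gamma_{k,j}|^2)^{1/2}>0$. **Polynomials.** Define polynomials in $X_1$ by $\varphi_0(X_1,l)=\varphi_0^\sharp(X_1,l)=s_{l,l}^{-1/2}$, $l\in\mathbb{N}_0$, and for $n\ge1$, $l\in\mathbb{N}_0$, $$\varphi_n(X_1,l)=\tfrac{1}{d_{l,n+l}}\big(X_1\varphi_{n-1}(X_1,l+1)-\gamma_{l,n+l}\varphi^\sharp_{n-1}(X_1,l)\big),$$ $$\varphi^\sharp_n(X_1,l)=\tfrac{1}{d_{l,n+l}}\big(-\overline{\gamma}_{l,n+l}X_1\varphi_{n-1}(X_1,l+1)+\varphi^\sharp_{n-1}(X_1,l)\big).$$ ($\{\varphi_n(X_1,0)\}_n$ are the orthonormal polynomials of $\phi$.) Write $\varphi_n(X_1,l)=\sum_{k=0}^na^l_{n,k}X_1^k$ and $\varphi_n^\sharp(X_1,l)=\sum_{k=0}^nb^l_{n,k}X_1^k$; the coefficient $a^l_{n,n}$ is positive. **Matrices.** $F_n(t)$ is the $(n+1)\times(n+1)$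 matrix with ones on the first subdiagonal and zeros elsewhere; $J(t)=\begin{bmatrix}1&0\\0&-1\end{bmatrix}$; and $$H_n(t)=\begin{bmatrix}\overline{a}^{\,t+1}_{n,0}&\cdots&\overline{a}^{\,t+1}_{n,n-1}&a^{t+1}_{n,n}\\ \overline{b}^{\,t}_{n,1}&\cdots&\overline{b}^{\,t}_{n,n}&0\end{bmatrix}.$$ *)

theory Defs
  imports
    "HOL-Library.Poly_Mapping"
    "Jordan_Normal_Form.Schur_Decomposition"
begin

datatype ncvar = V1 | V2

text \<open>Monomials are words in the two variables. They are wrapped in a datatype so that
  concatenation can serve as the (noncommutative) addition of exponents in
  \<^typ>\<open>'a \<Rightarrow>\<^sub>0 complex\<close>; the convolution product is then that of the free algebra.\<close>

datatype ncmonom = NCM (letters: "ncvar list")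

instantiation ncmonom :: monoid_add
begin
definition "0 = NCM []"
definition "u + v = NCM (letters u @ letters v)"
instance by standard (simp_all add: zero_ncmonom_def plus_ncmonom_def)
end

type_synonym ncpoly = "ncmonom \<Rightarrow>\<^sub>0 complex"

definition ncconst :: "complex \<Rightarrow> ncpoly" where
  "ncconst c = Poly_Mapping.single 0 c"

definition ncX1 :: ncpoly where "ncX1 = Poly_Mapping.single (NCM [V1]) 1"
definition ncX2 :: ncpoly where "ncX2 = Poly_Mapping.single (NCM [V2]) 1"

fun swap_var :: "ncvar \<Rightarrow> ncvar" where
  "swap_var V1 = V2"
| "swap_var V2 = V1"

definition monom_star :: "ncmonom \<Rightarrow> ncmonom" where
  "monom_star w = NCM (map swap_var (rev (letters w)))"

definition nc_star :: "ncpoly \<Rightarrow> ncpoly" where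
  "nc_star P = (\<Sum>w\<in>Poly_Mapping.keys P.
     Poly_Mapping.single (monom_star w) (cnj (Poly_Mapping.lookup P w)))"

definition nc_of_poly :: "complex poly \<Rightarrow> ncpoly" where
  "nc_of_poly p = (\<Sum>i\<le>degree p. ncconst (coeff p i) * ncX1 ^ i)"

definition nc_scale :: "complex \<Rightarrow> ncpoly \<Rightarrow> ncpoly" where
  "nc_scale c P = ncconst c * P"

lemma vector_space_nc: "vector_space nc_scale"
  by unfold_locales
    (simp_all add: nc_scale_def ncconst_def distrib_left distrib_right single_add
       mult_single flip: mult.assoc)

lemma monom_star_monom_star [simp]: "monom_star (monom_star w) = w"
proof -
  have "swap_var \<circ> swap_var = id"
    by (rule ext) (metis comp_apply id_apply ncvar.exhaust swap_var.simps)
  then show ?thesis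
    by (simp add: monom_star_def rev_map)
qed

lemma monom_star_add: "monom_star (u + v) = monom_star v + monom_star u"
  by (simp add: monom_star_def plus_ncmonom_def)

lemma lookup_nc_star:
  "Poly_Mapping.lookup (nc_star P) w = cnj (Poly_Mapping.lookup P (monom_star w))"
proof -
  have "Poly_Mapping.lookup (nc_star P) w = (\<Sum>v\<in>Poly_Mapping.keys P.
      if v = monom_star w then cnj (Poly_Mapping.lookup P v) else 0)"
    unfolding nc_star_def lookup_sum
    by (rule sum.cong) (auto simp: lookup_single when_def)
  then show ?thesis
    by (auto simp: in_keys_iff)
qed

lemma nc_star_single:
  "nc_star (Poly_Mapping.single w c) = Poly_Mapping.single (monom_star w) (cnj c)"
  by (rule poly_mapping_eqI) (auto simp: lookup_nc_star lookup_single when_def)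

lemma nc_star_X1: "nc_star ncX1 = ncX2" and nc_star_X2: "nc_star ncX2 = ncX1"
  by (simp_all add: ncX1_def ncX2_def nc_star_single monom_star_def)

lemma nc_star_add: "nc_star (P + Q) = nc_star P + nc_star Q"
  by (rule poly_mapping_eqI) (simp add: lookup_nc_star lookup_add)

lemma nc_star_nc_star: "nc_star (nc_star P) = P"
  by (rule poly_mapping_eqI) (simp add: lookup_nc_star)

lemma poly_mapping_as_sum_single:
  fixes P :: ncpoly
  shows "P = (\<Sum>w\<in>Poly_Mapping.keys P. Poly_Mapping.single w (Poly_Mapping.lookup P w))"
  by (rule poly_mapping_eqI)
    (auto simp: lookup_sum lookup_single when_def in_keys_iff)

lemma nc_star_sum: "nc_star (\<Sum>i\<in>A. f i) = (\<Sum>i\<in>A. nc_star (f i))"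
proof (cases "finite A")
  case True
  then show ?thesis
    by induction (simp_all add: nc_star_add, simp add: nc_star_def)
qed (simp add: nc_star_def)

lemma nc_star_mult: "nc_star (P * Q) = nc_star Q * nc_star P"
proof -
  let ?s = "\<lambda>P w. Poly_Mapping.single w (Poly_Mapping.lookup P w) :: ncpoly"
  let ?t = "\<lambda>P w. Poly_Mapping.single (monom_star w) (cnj (Poly_Mapping.lookup P w)) :: ncpoly"
  have "P * Q = (\<Sum>v\<in>Poly_Mapping.keys P. ?s P v) * (\<Sum>w\<in>Poly_Mapping.keys Q. ?s Q w)"
    by (simp flip: poly_mapping_as_sum_single)
  then have "nc_star (P * Q) =
      (\<Sum>v\<in>Poly_Mapping.keys P. \<Sum>w\<in>Poly_Mapping.keys Q. ?t Q w * ?t P v)"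
    by (simp add: sum_product nc_star_sum mult_single nc_star_single monom_star_add mult.commute)
  also have "\<dots> = nc_star Q * nc_star P"
    unfolding nc_star_def sum_product by (rule sum.swap)
  finally show ?thesis .
qed

lemma nc_star_scale: "nc_star (nc_scale c P) = nc_scale (cnj c) (nc_star P)"
proof -
  have "nc_scale c P = P * ncconst c" for c P
    unfolding nc_scale_def ncconst_def
    by (subst (1 2) poly_mapping_as_sum_single [of P])
      (simp add: sum_distrib_left sum_distrib_right mult_single mult.commute)
  moreover have "nc_star (ncconst c) = ncconst (cnj c)"
    by (simp add: ncconst_def nc_star_single monom_star_def zero_ncmonom_def)
  ultimately show ?thesis
    by (simp add: nc_scale_def nc_star_mult)
qed

text \<open>The order on \<^typ>\<open>complex\<close> is the one of \<^theory>\<open>HOL-Library.Complex_Order\<close>: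
  \<open>0 < z\<close> means that \<open>z\<close> is real and positive.\<close>

definition strictly_q_positive :: "(ncpoly \<Rightarrow> complex) \<Rightarrow> bool" where
  "strictly_q_positive \<phi> \<longleftrightarrow>
     (\<forall>p :: complex poly. p \<noteq> 0 \<longrightarrow> 0 < \<phi> (nc_star (nc_of_poly p) * nc_of_poly p))"

definition moment :: "(ncpoly \<Rightarrow> complex) \<Rightarrow> nat \<Rightarrow> nat \<Rightarrow> complex" where
  "moment \<phi> k j = \<phi> (nc_star (ncX1 ^ k) * ncX1 ^ j)"

definition defect :: "complex \<Rightarrow> complex" where
  "defect c = complex_of_real (sqrt (1 - (cmod c)\<^sup>2))"

definition Jrot :: "complex \<Rightarrow> complex mat" where
  "Jrot c = mat_of_rows_list 2 [[c, defect c], [defect c, - cnj c]]"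

function Umat :: "(nat \<Rightarrow> nat \<Rightarrow> complex) \<Rightarrow> nat \<Rightarrow> nat \<Rightarrow> complex mat" where
  "Umat \<gamma> k j = (if j \<le> k then 1\<^sub>m 1 else
     foldr (*)
       (map (\<lambda>i. diag_block_mat [1\<^sub>m (i - 1), Jrot (\<gamma> k (k + i)), 1\<^sub>m (j - k - i)])
          [1..<j - k + 1])
       (diag_block_mat [Umat \<gamma> (k + 1) j, 1\<^sub>m 1]))"
  by pat_completeness auto
termination by (relation "measure (\<lambda>(_, k, j). j - k)") auto

declare Umat.simps [simp del]

text \<open>For a strictly positive definite kernel the diagonal entries are positive, so
  \<^const>\<open>csqrt\<close> is the positive square root. Only the values \<open>\<gamma> k j\<close> with \<open>k \<le> j\<close> matter.\<close>

definition kernel_parameters ::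
    "(nat \<Rightarrow> nat \<Rightarrow> complex) \<Rightarrow> (nat \<Rightarrow> nat \<Rightarrow> complex) \<Rightarrow> bool" where
  "kernel_parameters s \<gamma> \<longleftrightarrow>
     (\<forall>k. \<gamma> k k = 0) \<and>
     (\<forall>k j. k \<le> j \<longrightarrow> cmod (\<gamma> k j) < 1) \<and>
     (\<forall>l m. l \<le> m \<longrightarrow> s l m = csqrt (s l l) * Umat \<gamma> l m $$ (0, 0) * csqrt (s m m))"

fun ophi :: "(nat \<Rightarrow> nat \<Rightarrow> complex) \<Rightarrow> (nat \<Rightarrow> nat \<Rightarrow> complex) \<Rightarrow> nat \<Rightarrow> nat \<Rightarrow> complex poly"
  and ophi_sharp :: "(nat \<Rightarrow> nat \<Rightarrow> complex) \<Rightarrow> (nat \<Rightarrow> nat \<Rightarrow> complex) \<Rightarrow> nat \<Rightarrow> nat \<Rightarrow> complex poly"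
where
  "ophi s \<gamma> 0 l = [:1 / csqrt (s l l):]"
| "ophi_sharp s \<gamma> 0 l = [:1 / csqrt (s l l):]"
| "ophi s \<gamma> (Suc n) l = smult (1 / defect (\<gamma> l (Suc n + l)))
     ([:0, 1:] * ophi s \<gamma> n (l + 1) - smult (\<gamma> l (Suc n + l)) (ophi_sharp s \<gamma> n l))"
| "ophi_sharp s \<gamma> (Suc n) l = smult (1 / defect (\<gamma> l (Suc n + l)))
     (smult (- cnj (\<gamma> l (Suc n + l))) ([:0, 1:] * ophi s \<gamma> n (l + 1)) + ophi_sharp s \<gamma> n l)"

definition disp_R :: "(nat \<Rightarrow> nat \<Rightarrow> complex) \<Rightarrow> nat \<Rightarrow> nat \<Rightarrow> complex mat" where
  "disp_R s n t = mat (n + 1) (n + 1) (\<lambda>(i, j). s (t + i) (t + j))"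

definition disp_F :: "nat \<Rightarrow> nat \<Rightarrow> complex mat" where
  "disp_F n t = mat (n + 1) (n + 1) (\<lambda>(i, j). if i = j + 1 then 1 else 0)"

definition disp_J :: "nat \<Rightarrow> complex mat" where
  "disp_J t = mat_of_rows_list 2 [[1, 0], [0, -1]]"

definition disp_H ::
    "(nat \<Rightarrow> nat \<Rightarrow> complex) \<Rightarrow> (nat \<Rightarrow> nat \<Rightarrow> complex) \<Rightarrow> nat \<Rightarrow> nat \<Rightarrow> complex mat" where
  "disp_H s \<gamma> n t = mat 2 (n + 1) (\<lambda>(i, j).
     if i = 0 then (if j < n then cnj (coeff (ophi s \<gamma> n (t + 1)) j) else coeff (ophi s \<gamma> n (t + 1)) n)
     else (if j < n then cnj (coeff (ophi_sharp s \<gamma> n t) (j + 1)) else 0))"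

text \<open>Meaningful for invertible matrices only, where \<^const>\<open>mat_inverse\<close> is not \<^const>\<open>None\<close>.\<close>

definition minv :: "complex mat \<Rightarrow> complex mat" where
  "minv A = the (mat_inverse A)"

end

theory Submission
  imports Defs
begin

text \<open>The sesquilinear form \<open>\<langle>p, q\<rangle> = \<phi>(q\<^sup>+ p)\<close> is an inner product on polynomials in one variable.
  Put \<open>Phi l n = X\<^sup>l \<phi>\<^sub>n(X, l)\<close> and \<open>Psi l n = X\<^sup>l \<phi>\<^sub>n\<^sup>\<sharp>(X, l)\<close>. Solving the recursions shows that
  \<open>J(\<gamma>\<^sub>l\<^sub>,\<^sub>n\<^sub>+\<^sub>l)\<close> takes the pair \<open>(Psi l (n - 1), Phi l n)\<close> to \<open>(Phi (l + 1) (n - 1), Psi l n)\<close>, so, purely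
  algebraically, \<open>U\<^sub>l\<^sub>,\<^sub>m\<close> takes the row \<open>Phi l 0, Phi l 1, \<dots>\<close> (forward Gram-Schmidt basis of
  \<open>X\<^sup>l, \<dots>, X\<^sup>m\<close>) to the row \<open>Psi m 0, Psi (m - 1) 1, \<dots>\<close> (backward basis). Its column 0 expands the
  normalised \<open>X\<^sup>m\<close> in the \<open>Phi l a\<close>; comparing with the defining property of the parameters gives
  \<open>Phi l n \<bottom> X\<^sup>l\<close>, and orthonormality follows by induction on \<open>n\<close>. Hence
  \<open>R\<^sub>n(t)\<^sup>-\<^sup>1\<close> is the Christoffel-Darboux matrix \<open>\<Sum>\<^bsub>a \<le> n\<^esub> v\<^sub>a v\<^sub>a\<^sup>*\<close>, with \<open>v\<^sub>a\<close> the coefficient vector of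
  \<open>\<phi>\<^sub>a(X, t)\<close>, and since the recursion is unitary for the signature \<open>(1, -1)\<close>, these sums telescope to
  the displacement equation.\<close>

section \<open>Rows of polynomials multiplied by matrices, and the factors of
  \<open>Umat\<close>\<close>

definition lin_comb :: "(nat \<Rightarrow> complex poly) \<Rightarrow> complex mat \<Rightarrow> nat \<Rightarrow> complex poly" where
  "lin_comb v M b = (\<Sum>a<dim_row M. smult (M $$ (a, b)) (v a))"

lemma smult_sum_right: "smult c (sum f A) = (\<Sum>x\<in>A. smult c (f x))"
  by (induction A rule: infinite_finite_induct) (auto simp: smult_add_right)

text \<open>\<open>lin_comb v M\<close> is the row \<open>v\<close> times \<open>M\<close>, so this
  is associativity of the product.\<close>

lemma lin_comb_mult:
  assumes "dim_col M = dim_row N" "b < dim_col N"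
  shows "lin_comb v (M * N) b = lin_comb (lin_comb v M) N b"
proof -
  have "lin_comb v (M * N) b =
      (\<Sum>a<dim_row M. \<Sum>c<dim_row N. smult (M $$ (a, c) * N $$ (c, b)) (v a))"
    using assms by (simp add: lin_comb_def times_mat_def scalar_prod_def smult_sum atLeast0LessThan)
  also have "\<dots> = lin_comb (lin_comb v M) N b"
    unfolding lin_comb_def smult_sum_right
    by (subst sum.swap) (simp add: mult.commute)
  finally show ?thesis .
qed

lemma lin_comb_cong:
  "(\<And>a. a < dim_row M \<Longrightarrow> v a = w a) \<Longrightarrow> lin_comb v M b = lin_comb w M b"
  unfolding lin_comb_def by (rule sum.cong) auto

lemma lin_comb_direct_sum_one:
  assumes "M \<in> carrier_mat n n" "b \<le> n"
  shows "lin_comb v (diag_block_mat [M, 1\<^sub>m 1]) b = (if b = n then v n else lin_comb v M b)"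
  using assms by (auto simp: lin_comb_def Let_def)

text \<open>The \<open>i\<close>-th factor of \<open>Umat\<close> for \<open>n = j - k\<close>.
  Counting starts at 1, so the rotation mixes positions \<open>i - 1\<close> and
  \<open>i\<close>.\<close>

definition rot_factor :: "nat \<Rightarrow> nat \<Rightarrow> complex \<Rightarrow> complex mat" where
  "rot_factor n i c = diag_block_mat [1\<^sub>m (i - 1), Jrot c, 1\<^sub>m (n - i)]"

lemma dim_Jrot [simp]: "dim_row (Jrot c) = 2" "dim_col (Jrot c) = 2"
  by (simp_all add: Jrot_def mat_of_rows_list_def)

lemma Jrot_entries [simp]:
  "Jrot c $$ (0, 0) = c" "Jrot c $$ (0, Suc 0) = defect c"
  "Jrot c $$ (Suc 0, 0) = defect c" "Jrot c $$ (Suc 0, Suc 0) = - cnj c"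
  by (simp_all add: Jrot_def mat_of_rows_list_def)

lemma rot_factor_carrier:
  assumes "1 \<le> i" "i \<le> n"
  shows "rot_factor n i c \<in> carrier_mat (n + 1) (n + 1)"
  using assms by (auto simp: rot_factor_def Let_def)

lemma rot_factor_entry:
  assumes "1 \<le> i" "i \<le> n" "a \<le> n" "b \<le> n"
  shows "rot_factor n i c $$ (a, b) =
    (if a = i - 1 \<and> b = i - 1 then c
     else if a = i - 1 \<and> b = i \<or> a = i \<and> b = i - 1 then defect c
     else if a = i \<and> b = i then - cnj c
     else if a = b then 1 else 0)"
proof -
  obtain m where m: "i = Suc m" using assms(1) by (cases i) auto
  have split: "x < m \<or> x = m \<or> x = Suc m \<or> x > Suc m" for x by linarith
  show ?thesis
    using split [of a] split [of b] assms unfolding m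
    by (elim disjE) (auto simp: rot_factor_def Let_def)
qed

lemma lin_comb_rot_factor:
  assumes "1 \<le> i" "i \<le> n" "b \<le> n"
  shows "lin_comb v (rot_factor n i c) b =
    (if b = i - 1 then smult c (v (i - 1)) + smult (defect c) (v i)
     else if b = i then smult (defect c) (v (i - 1)) - smult (cnj c) (v i)
     else v b)"
proof -
  let ?G = "rot_factor n i c"
  have dim: "dim_row ?G = Suc n"
    using rot_factor_carrier [OF assms(1,2)] by (metis Suc_eq_plus1 carrier_matD(1))
  have "lin_comb v ?G b = (\<Sum>a<Suc n. smult (?G $$ (a, b)) (v a))"
    unfolding lin_comb_def dim ..
  also have "\<dots> = (\<Sum>a\<in>{i - 1, i, b}. smult (?G $$ (a, b)) (v a))"
    using assms by (intro sum.mono_neutral_right) (auto simp: rot_factor_entry)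
  \<comment> \<open>\<open>b\<close> may coincide with a rotated position; the split lists the
    indices without repetition, so that the sum can be evaluated.\<close>
  also have "{i - 1, i, b} = (if b \<in> {i - 1, i} then {i - 1, i} else {i - 1, i, b})"
    by auto
  also have "(\<Sum>a\<in>\<dots>. smult (?G $$ (a, b)) (v a)) =
      (if b = i - 1 then smult c (v (i - 1)) + smult (defect c) (v i)
     else if b = i then smult (defect c) (v (i - 1)) - smult (cnj c) (v i) else v b)"
    using assms by (auto simp: rot_factor_entry)
  finally show ?thesis .
qed

lemma foldr_mult_carrier:
  assumes "\<And>M. M \<in> set Ms \<Longrightarrow> M \<in> carrier_mat n n" "T \<in> carrier_mat n n"
  shows "foldr (*) Ms T \<in> carrier_mat n n"
  using assms(1)
proof (induction Ms)
  case (Cons M Ms)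
  then show ?case by (auto intro: mult_carrier_mat)
qed (simp add: assms(2))

lemma Umat_diag: "Umat \<gamma> k k = 1\<^sub>m 1"
  by (simp add: Umat.simps [of _ k k])

lemma Umat_Suc: "Umat \<gamma> k (k + Suc n) =
    foldr (*) (map (\<lambda>i. rot_factor (Suc n) i (\<gamma> k (k + i))) [Suc 0..<Suc (Suc n)])
      (diag_block_mat [Umat \<gamma> (Suc k) (Suc k + n), 1\<^sub>m 1])"
  by (simp add: Umat.simps [of _ k "Suc (k + n)"] rot_factor_def del: upt_Suc diag_block_mat.simps)

lemma Umat_carrier: "Umat \<gamma> k (k + n) \<in> carrier_mat (n + 1) (n + 1)"
proof (induction n arbitrary: k)
  case 0
  then show ?case by (simp add: Umat_diag)
next
  case (Suc n)
  have "diag_block_mat [Umat \<gamma> (Suc k) (Suc k + n), 1\<^sub>m 1] \<in> carrier_mat (Suc n + 1) (Suc n + 1)"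
    using Suc.IH [of "Suc k"] by (auto simp: Let_def)
  then show ?case
    unfolding Umat_Suc
    by (intro foldr_mult_carrier) (auto intro!: rot_factor_carrier [simplified])
qed

text \<open>A row meets the leftmost factor first. With \<open>w i\<close> the row after
  \<open>i\<close> factors, peeling off one factor moves from \<open>w i\<close> to
  \<open>w (Suc i)\<close>; the downward induction starts at \<open>i = n\<close>, where no factor
  is left.\<close>

lemma lin_comb_foldr:
  assumes step: "\<And>i b. i < n \<Longrightarrow> b \<le> n \<Longrightarrow> lin_comb (w i) (G (Suc i)) b = w (Suc i) b"
    and G: "\<And>i. 1 \<le> i \<Longrightarrow> i \<le> n \<Longrightarrow> G i \<in> carrier_mat (n + 1) (n + 1)"
    and T: "T \<in> carrier_mat (n + 1) (n + 1)"
    and "i \<le> n" "b \<le> n"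
  shows "lin_comb (w i) (foldr (*) (map G [Suc i..<Suc n]) T) b = lin_comb (w n) T b"
  using \<open>i \<le> n\<close>
proof (induction rule: inc_induct)
  case (step i)
  let ?T = "foldr (*) (map G [Suc (Suc i)..<Suc n]) T"
  have T': "?T \<in> carrier_mat (n + 1) (n + 1)"
    using G T by (intro foldr_mult_carrier) auto
  have G': "G (Suc i) \<in> carrier_mat (n + 1) (n + 1)"
    using G step.hyps by simp
  have "lin_comb (w i) (G (Suc i) * ?T) b = lin_comb (lin_comb (w i) (G (Suc i))) ?T b"
    using T' G' \<open>b \<le> n\<close> by (intro lin_comb_mult) auto
  also have "\<dots> = lin_comb (w (Suc i)) ?T b"
    using T' assms(1) step.hyps by (intro lin_comb_cong) auto
  finally show ?case
    using step by (simp add: upt_conv_Cons del: upt_Suc)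
qed simp

section \<open>Defects, positive square roots and monomials\<close>

lemma cnj_defect [simp]: "cnj (defect c) = defect c"
  by (simp add: defect_def)

lemma defect_square: "cmod c < 1 \<Longrightarrow> defect c * defect c = 1 - c * cnj c"
  using power_mono [of "cmod c" 1 2]
  by (simp add: defect_def complex_norm_square [symmetric] flip: of_real_mult)

lemma defect_pos: "cmod c < 1 \<Longrightarrow> \<exists>r>0. defect c = complex_of_real r"
  using power_strict_mono [of "cmod c" 1 2] by (auto simp: defect_def)

lemma defect_nonzero: "cmod c < 1 \<Longrightarrow> defect c \<noteq> 0"
  using defect_pos by fastforce

lemma csqrt_of_pos:
  assumes "0 < (z :: complex)"
  shows "\<exists>r>0. csqrt z = complex_of_real r"
  using assms by (metis less_complex_def complex_is_Real_iff csqrt_of_real_nonneg less_eq_real_def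
      of_real_Re real_sqrt_gt_zero zero_complex.simps)

lemma monom_shift: "monom 1 l * ([:0, 1:] * p) = monom 1 (Suc l) * (p :: 'a :: comm_semiring_1 poly)"
  by (simp add: monom_Suc)

lemma poly_as_monom_sum:
  fixes p :: "'a :: comm_semiring_1 poly"
  assumes "degree p \<le> n"
  shows "p = (\<Sum>k\<le>n. smult (coeff p k) (monom 1 k))"
  using poly_as_sum_of_monoms' [OF assms] by (simp add: smult_monom)

section \<open>The inner product, and the recursions as rotations\<close>

locale moment_kernel =
  fixes ip :: "complex poly \<Rightarrow> complex poly \<Rightarrow> complex" and s \<gamma> :: "nat \<Rightarrow> nat \<Rightarrow> complex"
  assumes ip_add: "ip (p + q) r = ip p r + ip q r"
    and ip_smult: "ip (smult c p) r = c * ip p r"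
    and ip_herm: "ip q p = cnj (ip p q)"
    and ip_pos: "p \<noteq> 0 \<Longrightarrow> 0 < ip p p"
    and moments: "s k j = ip (monom 1 j) (monom 1 k)"
    and params: "kernel_parameters s \<gamma>"
begin

lemma ip_add_right: "ip r (p + q) = ip r p + ip r q"
  by (metis ip_add ip_herm complex_cnj_add)

lemma ip_smult_right: "ip r (smult c p) = cnj c * ip r p"
  by (metis ip_smult ip_herm complex_cnj_mult)

lemma ip_zero [simp]: "ip 0 p = 0" "ip p 0 = 0"
  using ip_smult [of 0 0 p] ip_smult_right [of p 0 0] by simp_all

lemma ip_diff: "ip (p - q) r = ip p r - ip q r"
  using ip_add [of "p - q" q r] by simp

lemma ip_diff_right: "ip r (p - q) = ip r p - ip r q"
  using ip_add_right [of r "p - q" q] by simp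

lemma ip_sum: "ip (\<Sum>a\<in>A. f a) r = (\<Sum>a\<in>A. ip (f a) r)"
  by (induction A rule: infinite_finite_induct) (simp_all add: ip_add)

lemma ip_sum_right: "ip r (\<Sum>a\<in>A. f a) = (\<Sum>a\<in>A. ip r (f a))"
  by (induction A rule: infinite_finite_induct) (simp_all add: ip_add_right)

lemma ip_zero_sym: "ip p q = 0 \<Longrightarrow> ip q p = 0"
  by (metis ip_herm complex_cnj_zero)

lemma gamma_less: "cmod (\<gamma> l (n + l)) < 1"
  using params le_add2 unfolding kernel_parameters_def by blast

lemma csqrt_diag: "\<exists>r>0. csqrt (s l l) = complex_of_real r"
  by (intro csqrt_of_pos) (simp add: moments ip_pos)

text \<open>The factor \<open>monom 1 l\<close> absorbs the variable in the recursion, so that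
  \<open>Phi_Suc\<close> and \<open>Psi_Suc\<close> have scalar coefficients only.\<close>

definition Phi where "Phi l n = monom 1 l * ophi s \<gamma> n l"
definition Psi where "Psi l n = monom 1 l * ophi_sharp s \<gamma> n l"

lemma Phi_0: "Phi l 0 = monom (1 / csqrt (s l l)) l"
  by (simp add: Phi_def mult.commute smult_monom)

lemma Psi_0: "Psi l 0 = Phi l 0"
  by (simp add: Phi_def Psi_def)

lemma Phi_Suc: "Phi l (Suc n) = smult (1 / defect (\<gamma> l (Suc n + l)))
    (Phi (Suc l) n - smult (\<gamma> l (Suc n + l)) (Psi l n))"
  unfolding Phi_def Psi_def ophi.simps mult_smult_right right_diff_distrib monom_shift by simp

lemma Psi_Suc: "Psi l (Suc n) = smult (1 / defect (\<gamma> l (Suc n + l)))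
    (Psi l n - smult (cnj (\<gamma> l (Suc n + l))) (Phi (Suc l) n))"
  unfolding Phi_def Psi_def ophi_sharp.simps mult_smult_right distrib_left monom_shift by simp

lemma degree_ophi: "degree (ophi s \<gamma> n l) \<le> n" "degree (ophi_sharp s \<gamma> n l) \<le> n"
proof (induction n arbitrary: l)
  case (Suc n)
  have "degree (pCons 0 (ophi s \<gamma> n (l + 1))) \<le> Suc n" for l
    using Suc.IH(1) [of "l + 1"] by (intro order_trans [OF degree_pCons_le]) simp
  then have X: "degree (smult c ([:0, 1:] * ophi s \<gamma> n (l + 1))) \<le> Suc n" for c l
    by (intro order_trans [OF degree_smult_le]) simp
  have Y: "degree (smult c (ophi_sharp s \<gamma> n l)) \<le> Suc n" for c l
    using Suc.IH(2) [of l] by (intro order_trans [OF degree_smult_le]) simp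
  {
    case 1
    show ?case unfolding ophi.simps
      using X [of 1 l] Y [of 1 l] Y by (intro order_trans [OF degree_smult_le] degree_diff_le) (simp_all only: smult_1_left)
  next
    case 2
    show ?case unfolding ophi_sharp.simps
      using X [of 1 l] Y [of 1 l] X by (intro order_trans [OF degree_smult_le] degree_add_le) (simp_all only: smult_1_left)
  }
qed simp_all

text \<open>The sharp polynomial does not reach degree \<open>Suc n\<close>, so each step only
  divides the leading coefficient by a positive defect.\<close>

lemma ophi_lead: "\<exists>r>0. coeff (ophi s \<gamma> n l) n = complex_of_real r"
proof (induction n arbitrary: l)
  case 0
  obtain r where "r > 0" "csqrt (s l l) = complex_of_real r" using csqrt_diag by blast
  then show ?case by (intro exI [of _ "1 / r"]) simp
next
  case (Suc n)
  obtain r where r: "r > 0" "coeff (ophi s \<gamma> n (Suc l)) n = complex_of_real r" using Suc by blast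
  obtain d where d: "d > 0" "defect (\<gamma> l (Suc n + l)) = complex_of_real d"
    using defect_pos gamma_less by blast
  have "coeff (ophi_sharp s \<gamma> n l) (Suc n) = 0"
    using degree_ophi(2) [of n l] by (simp add: coeff_eq_0)
  then have "coeff (ophi s \<gamma> (Suc n) l) (Suc n) = complex_of_real (r / d)"
    using r d by simp
  then show ?case using r d by (metis divide_pos_pos)
qed

text \<open>The left-hand sides are what \<open>lin_comb_rot_factor\<close> produces at the two
  mixed positions.\<close>

lemma rotation:
  assumes "g = \<gamma> l (Suc n + l)"
  shows "smult g (Psi l n) + smult (defect g) (Phi l (Suc n)) = Phi (Suc l) n"
    and "smult (defect g) (Psi l n) - smult (cnj g) (Phi l (Suc n)) = Psi l (Suc n)"
proof -
  have g: "cmod g < 1" using gamma_less [of l "Suc n"] assms by simp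
  note nz = defect_nonzero [OF g] and sq = defect_square [OF g]
  have P: "Phi l (Suc n) = smult (1 / defect g) (Phi (Suc l) n - smult g (Psi l n))"
    and S: "Psi l (Suc n) = smult (1 / defect g) (Psi l n - smult (cnj g) (Phi (Suc l) n))"
    by (simp_all only: Phi_Suc Psi_Suc assms)
  show "smult g (Psi l n) + smult (defect g) (Phi l (Suc n)) = Phi (Suc l) n"
    using nz by (simp add: P)
  \<comment> \<open>Multiplying by the defect clears the denominator in \<open>P\<close>; the defect
    is nonzero and is cancelled at the end.\<close>
  have "smult (defect g) (smult (defect g) (Psi l n) - smult (cnj g) (Phi l (Suc n))) =
      smult (defect g * defect g + g * cnj g) (Psi l n) - smult (cnj g) (Phi (Suc l) n)"
    using nz by (simp add: P smult_diff_right smult_add_left mult.commute)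
  also have "\<dots> = smult (defect g) (Psi l (Suc n))"
    using nz by (simp add: sq S)
  finally show "smult (defect g) (Psi l n) - smult (cnj g) (Phi l (Suc n)) = Psi l (Suc n)"
    using nz by (metis smult_smult smult_1_left left_inverse)
qed

text \<open>The \<open>n\<close> rotations of level \<open>l\<close> turn the row
  \<open>Phi l\<close> into \<open>Phi (Suc l)\<close> with \<open>Psi l n\<close> in the last
  place. The block \<open>1\<close> keeps that entry, and the induction hypothesis at
  \<open>Suc l\<close> treats the others.\<close>

lemma lin_comb_Umat:
  assumes "b \<le> n"
  shows "lin_comb (Phi l) (Umat \<gamma> l (l + n)) b = Psi (l + n - b) b"
  using assms
proof (induction n arbitrary: l b)
  case 0
  then show ?case by (simp add: lin_comb_def Umat_diag Psi_0)
next
  case (Suc n)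
  \<comment> \<open>\<open>w i\<close> is the row of polynomials after the first \<open>i\<close> rotations.\<close>
  define w where "w i a = (if a < i then Phi (Suc l) a else if a = i then Psi l a else Phi l a)" for i a
  let ?G = "\<lambda>i. rot_factor (Suc n) i (\<gamma> l (l + i))"
  let ?U = "Umat \<gamma> (Suc l) (Suc l + n)"
  have U: "?U \<in> carrier_mat (Suc n) (Suc n)"
    using Umat_carrier [of \<gamma> "Suc l" n] by simp
  have T: "diag_block_mat [?U, 1\<^sub>m 1] \<in> carrier_mat (Suc n + 1) (Suc n + 1)"
    using U by (auto simp: Let_def)
  have step: "lin_comb (w i) (?G (Suc i)) b = w (Suc i) b" if "i < Suc n" "b \<le> Suc n" for i b
    using that rotation [OF refl, of l i]
    by (subst lin_comb_rot_factor) (auto simp: w_def add.commute)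
  \<comment> \<open>The row \<open>w 0\<close> has \<open>Psi l 0\<close> in position 0, which
    equals \<open>Phi l 0\<close>.\<close>
  have "Phi l = w 0"
    by (auto simp: w_def fun_eq_iff Psi_0)
  moreover have "lin_comb (w 0) (foldr (*) (map ?G [Suc 0..<Suc (Suc n)]) (diag_block_mat [?U, 1\<^sub>m 1])) b
      = lin_comb (w (Suc n)) (diag_block_mat [?U, 1\<^sub>m 1]) b"
    by (rule lin_comb_foldr) (use step T rot_factor_carrier Suc.prems in auto)
  ultimately have "lin_comb (Phi l) (Umat \<gamma> l (l + Suc n)) b
      = lin_comb (w (Suc n)) (diag_block_mat [?U, 1\<^sub>m 1]) b"
    by (simp only: Umat_Suc)
  also have "\<dots> = (if b = Suc n then Psi l (Suc n) else lin_comb (w (Suc n)) ?U b)"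
    using lin_comb_direct_sum_one [OF U, of b] Suc.prems by (simp add: w_def del: diag_block_mat.simps)
  also have "lin_comb (w (Suc n)) ?U b = lin_comb (Phi (Suc l)) ?U b"
    using U by (intro lin_comb_cong) (auto simp: w_def)
  finally show ?case
    using Suc.IH [of b "Suc l"] Suc.prems by auto
qed

section \<open>Orthonormality\<close>

lemma Phi_as_sum:
  assumes "m \<le> n"
  shows "Phi l m = (\<Sum>k\<le>n. smult (coeff (ophi s \<gamma> m l) k) (monom 1 (l + k)))"
    and "Psi l m = (\<Sum>k\<le>n. smult (coeff (ophi_sharp s \<gamma> m l) k) (monom 1 (l + k)))"
  unfolding Phi_def Psi_def
  by (subst poly_as_monom_sum [OF order_trans [OF degree_ophi(1) assms]]
        poly_as_monom_sum [OF order_trans [OF degree_ophi(2) assms]],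
      simp add: sum_distrib_left mult_monom)+

text \<open>The sums may run past the degree, where coefficients vanish; this fits matrices of size
  \<open>n + 1\<close>.\<close>

lemma ip_Phi:
  assumes "m \<le> n"
  shows "ip p (Phi l m) = (\<Sum>k\<le>n. cnj (coeff (ophi s \<gamma> m l) k) * ip p (monom 1 (l + k)))"
    and "ip p (Psi l m) = (\<Sum>k\<le>n. cnj (coeff (ophi_sharp s \<gamma> m l) k) * ip p (monom 1 (l + k)))"
  by (simp_all add: Phi_as_sum [OF assms] ip_sum_right ip_smult_right)

lemma ip_Phi_0: "ip p (Phi l 0) = ip p (monom 1 l) / csqrt (s l l)"
proof -
  obtain r where "csqrt (s l l) = complex_of_real r" using csqrt_diag by blast
  then show ?thesis by (simp add: ip_Phi [OF order_refl])
qed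

text \<open>The indices swap because \<open>s l m\<close> has the starred power \<open>l\<close>,
  which sits in the second, conjugate-linear slot of \<open>ip\<close>.\<close>

lemma ip_Phi_0_Phi_0: "ip (Phi m 0) (Phi l 0) = s l m / (csqrt (s l l) * csqrt (s m m))"
proof -
  have "Phi m 0 = smult (1 / csqrt (s m m)) (monom 1 m)"
    by (simp add: Phi_0 smult_monom)
  then have "ip (Phi m 0) (monom 1 l) = s l m / csqrt (s m m)"
    by (simp only: ip_smult moments) simp
  then show ?thesis by (simp add: ip_Phi_0)
qed

lemma ip_monom_zero_of_Phi_0: "ip (Phi l n) (Phi l 0) = 0 \<Longrightarrow> ip (Phi l n) (monom 1 l) = 0"
  using csqrt_diag [of l] by (auto simp: ip_Phi_0)

lemma Phi_norm_0: "ip (Phi l 0) (Phi l 0) = 1"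
proof -
  have "csqrt (s l l) * csqrt (s l l) = s l l"
    by (metis power2_csqrt power2_eq_square)
  then show ?thesis using csqrt_diag [of l] by (auto simp: ip_Phi_0_Phi_0)
qed

text \<open>The conditions on \<open>Psi\<close> are only needed to carry the induction through.\<close>

definition orthonormal_step where
  "orthonormal_step n \<longleftrightarrow> (\<forall>l.
     ip (Phi l n) (Phi l n) = 1 \<and> ip (Psi l n) (Psi l n) = 1 \<and>
     (\<forall>k<n. ip (Phi l n) (monom 1 (l + k)) = 0) \<and>
     (\<forall>k. 1 \<le> k \<longrightarrow> k \<le> n \<longrightarrow> ip (Psi l n) (monom 1 (l + k)) = 0))"

lemma coeff_Phi: "coeff (Phi l n) (l + k) = coeff (ophi s \<gamma> n l) k"
  by (simp add: Phi_def coeff_monom_mult)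

text \<open>Column 0 of \<open>Umat\<close> expands the normalised \<open>X^(l + n)\<close> in the
  \<open>Phi l a\<close>. Pairing with \<open>Phi l 0\<close> leaves the terms \<open>a = 0\<close>
  and \<open>a = n\<close>; by the choice of the parameters the first is already the whole inner
  product, so the second is zero, while its coefficient is not.\<close>

lemma Phi_orth_first:
  assumes IH: "\<And>a. a < n \<Longrightarrow> orthonormal_step a" and "0 < n"
  shows "ip (Phi l n) (Phi l 0) = 0"
proof -
  let ?U = "Umat \<gamma> l (l + n)"
  have dim: "dim_row ?U = Suc n"
    using Umat_carrier [of \<gamma> l n] by simp
  have expand: "Phi (l + n) 0 = (\<Sum>a\<le>n. smult (?U $$ (a, 0)) (Phi l a))"
    using lin_comb_Umat [of 0 n l] by (simp add: lin_comb_def dim Psi_0 lessThan_Suc_atMost)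
  have "ip (Phi l a) (Phi l 0) = (if a = 0 then 1 else 0)" if "a < n" for a
    using IH [OF that, unfolded orthonormal_step_def, rule_format, of l]
    by (cases "a = 0") (auto simp: Phi_norm_0 ip_Phi_0 dest: spec [of _ "0 :: nat"])
  then have "(\<Sum>a<n. ?U $$ (a, 0) * ip (Phi l a) (Phi l 0)) = (\<Sum>a<n. if a = 0 then ?U $$ (0, 0) else 0)"
    by (intro sum.cong) auto
  then have "(\<Sum>a<n. ?U $$ (a, 0) * ip (Phi l a) (Phi l 0)) = ?U $$ (0, 0)"
    using \<open>0 < n\<close> by simp
  then have "ip (Phi (l + n) 0) (Phi l 0) = ?U $$ (0, 0) + ?U $$ (n, 0) * ip (Phi l n) (Phi l 0)"
    unfolding expand by (simp add: ip_add ip_sum ip_smult flip: lessThan_Suc_atMost)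
  moreover have "s l (l + n) = csqrt (s l l) * ?U $$ (0, 0) * csqrt (s (l + n) (l + n))"
    using params le_add1 unfolding kernel_parameters_def by blast
  then have "ip (Phi (l + n) 0) (Phi l 0) = ?U $$ (0, 0)"
    using csqrt_diag [of l] csqrt_diag [of "l + n"] by (auto simp: ip_Phi_0_Phi_0)
  \<comment> \<open>Of the \<open>Phi l a\<close> in the expansion only \<open>Phi l n\<close>
    reaches the degree \<open>l + n\<close> of the left-hand side.\<close>
  moreover have "?U $$ (n, 0) \<noteq> 0"
  proof -
    have "coeff (Phi l a) (l + n) = 0" if "a < n" for a
      using degree_ophi(1) [of a l] that by (simp add: coeff_Phi coeff_eq_0)
    then have "coeff (Phi (l + n) 0) (l + n) = ?U $$ (n, 0) * coeff (Phi l n) (l + n)"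
      unfolding expand by (simp add: coeff_sum flip: lessThan_Suc_atMost)
    moreover have "coeff (Phi (l + n) 0) (l + n) \<noteq> 0"
      using csqrt_diag [of "l + n"] by (auto simp: Phi_0)
    ultimately show ?thesis by auto
  qed
  ultimately show ?thesis by simp
qed

text \<open>Strong induction, because \<open>Phi_orth_first\<close> calls on all smaller
  orders.\<close>

lemma orthonormal_step: "orthonormal_step n"
proof (induction n rule: less_induct)
  case (less n)
  show ?case
  proof (cases n)
    case 0
    then show ?thesis by (simp add: orthonormal_step_def Phi_norm_0 Psi_0)
  next
    case (Suc n')
    show ?thesis unfolding orthonormal_step_def
    proof
      fix l
      define g where "g = \<gamma> l (Suc n' + l)"
      define A B where "A = Phi (Suc l) n'" and "B = Psi l n'"
      have g: "cmod g < 1" using gamma_less [of l "Suc n'"] by (simp add: g_def)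
      note nz = defect_nonzero [OF g] and sq = defect_square [OF g]
      have P: "Phi l n = smult (1 / defect g) (A - smult g B)"
        and S: "Psi l n = smult (1 / defect g) (B - smult (cnj g) A)"
        by (simp_all only: Suc Phi_Suc Psi_Suc A_def B_def g_def)
      have IH: "orthonormal_step n'" using less Suc by simp
      have AA: "ip A A = 1" and BB: "ip B B = 1"
        using IH by (simp_all add: A_def B_def orthonormal_step_def)
      \<comment> \<open>\<open>A\<close> is based at \<open>Suc l\<close>, so it is orthogonal to
        \<open>X^(l + 1)\<close> up to \<open>X^(l + n')\<close>.\<close>
      have A0: "ip A (monom 1 (l + k)) = 0" if "1 \<le> k" "k \<le> n'" for k
      proof -
        have "l + k = Suc l + (k - 1)" "k - 1 < n'" using that by auto
        then show ?thesis using IH unfolding A_def orthonormal_step_def by metis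
      qed
      have B0: "ip B (monom 1 (l + k)) = 0" if "1 \<le> k" "k \<le> n'" for k
        using IH that by (simp add: B_def orthonormal_step_def)
      \<comment> \<open>\<open>X^l\<close> is the one power below \<open>X^(l + n)\<close> that
        \<open>A0\<close> and \<open>B0\<close> do not settle; here the parameters enter.\<close>
      have "ip (Phi l n) (Phi l 0) = 0"
        using less Suc by (intro Phi_orth_first) auto
      then have "ip (Phi l n) (monom 1 l) = 0"
        by (rule ip_monom_zero_of_Phi_0)
      then have PX: "ip (Phi l n) (monom 1 (l + k)) = 0" if "k \<le> n'" for k
        using that A0 [of k] B0 [of k]
        by (cases "k = 0") (simp_all add: P ip_smult ip_diff)
      \<comment> \<open>\<open>B\<close> is a combination of \<open>X^l\<close> up to
        \<open>X^(l + n')\<close>. The parameter is thereby identified as the inner product of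
        \<open>A\<close> and \<open>B\<close>.\<close>
      then have "ip (Phi l n) B = 0"
        by (simp add: B_def ip_Phi(2) [OF order_refl])
      then have AB: "ip A B = g"
        using nz by (simp add: P ip_smult ip_diff BB)
      then have BA: "ip B A = cnj g"
        by (metis ip_herm)
      \<comment> \<open>Both numerators, \<open>A - g B\<close> and \<open>B - cnj g A\<close>, have
        squared norm \<open>1 - g * cnj g\<close>, the squared defect.\<close>
      have norms: "ip (Phi l n) (Phi l n) = 1" "ip (Psi l n) (Psi l n) = 1"
        using nz sq by (simp_all add: P S ip_smult ip_smult_right ip_diff ip_diff_right
            AA BB AB BA divide_simps algebra_simps)
      have "ip (Psi l n) A = 0"
        by (simp add: S ip_smult ip_diff AA BA)
      moreover have SX: "ip (Psi l n) (monom 1 (l + k)) = 0" if "1 \<le> k" "k \<le> n'" for k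
        using that A0 B0 by (simp add: S ip_smult ip_diff)
      \<comment> \<open>In the expansion of \<open>A\<close> only the top power
        \<open>X^(l + n)\<close> escapes \<open>SX\<close>; its coefficient is nonzero by
        \<open>ophi_lead\<close>.\<close>
      ultimately have "cnj (coeff (ophi s \<gamma> n' (Suc l)) n') * ip (Psi l n) (monom 1 (l + n)) = 0"
        using SX [of "Suc _"] by (simp add: A_def ip_Phi(1) [OF order_refl] Suc flip: lessThan_Suc_atMost)
      then have "ip (Psi l n) (monom 1 (l + n)) = 0"
        using ophi_lead [of n' "Suc l"] by auto
      then show "ip (Phi l n) (Phi l n) = 1 \<and> ip (Psi l n) (Psi l n) = 1 \<and>
          (\<forall>k<n. ip (Phi l n) (monom 1 (l + k)) = 0) \<and>
          (\<forall>k. 1 \<le> k \<longrightarrow> k \<le> n \<longrightarrow> ip (Psi l n) (monom 1 (l + k)) = 0)"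
        using norms PX SX Suc by (auto simp: le_Suc_eq)
    qed
  qed
qed

lemma ophi_orthonormal: "ip (Phi l m) (Phi l n) = (if m = n then 1 else 0)"
proof -
  have *: "ip (Phi l m) (Phi l n) = 0" if "n < m" for m n
    unfolding ip_Phi(1) [OF order_refl] using orthonormal_step [of m] that
    by (intro sum.neutral) (auto simp: orthonormal_step_def)
  show ?thesis
    using orthonormal_step [of n] * [of n m] ip_zero_sym [OF * [of m n]]
    by (cases m n rule: linorder_cases) (auto simp: orthonormal_step_def)
qed

end

section \<open>Inverse matrices, and entries of the two sides of the equation\<close>

lemma mat_adjoint_eq: "mat_adjoint A = mat (dim_col A) (dim_row A) (\<lambda>(i, j). cnj (A $$ (j, i)))"
  by (rule eq_matI) (simp_all add: mat_adjoint_def mat_of_rows_def)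

text \<open>A left inverse of a square matrix is two-sided, so \<open>A\<close> is a unit and
  \<open>mat_inverse\<close> cannot return \<open>None\<close>; uniqueness of inverses identifies
  its result with \<open>B\<close>.\<close>

lemma minv_eqI:
  assumes "A \<in> carrier_mat n n" "B \<in> carrier_mat n n" "B * A = 1\<^sub>m n"
  shows "invertible_mat A" "minv A = B"
proof -
  have AB: "A * B = 1\<^sub>m n"
    using assms mat_mult_left_right_inverse by blast
  then show "invertible_mat A"
    using assms unfolding invertible_mat_def inverts_mat_def by auto
  have "A \<in> Units (ring_mat TYPE(complex) n undefined)"
    using assms AB by (auto simp: Units_def ring_mat_simps intro!: bexI [of _ B])
  then obtain C where C: "mat_inverse A = Some C"
    using mat_inverse(1) [OF assms(1), where b = undefined] by (cases "mat_inverse A") auto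
  then have "A * C = 1\<^sub>m n" "C \<in> carrier_mat n n"
    using mat_inverse(2) [OF assms(1)] by auto
  then have "B = B * A * C"
    using assms(1,2) assoc_mult_mat [of B n n A n C n] by simp
  also have "\<dots> = C"
    using \<open>C \<in> carrier_mat n n\<close> assms(3) by simp
  finally have "B = C" .
  then show "minv A = B"
    by (simp add: minv_def C)
qed

text \<open>\<open>disp_F\<close> is a shift: the product drops the first row and column of
  \<open>M\<close> and pads with zeros at the end.\<close>

lemma disp_F_compress:
  assumes M: "M \<in> carrier_mat (n + 1) (n + 1)"
  shows "mat_adjoint (disp_F n t) * M * disp_F n t =
    mat (n + 1) (n + 1) (\<lambda>(i, j). if i < n \<and> j < n then M $$ (Suc i, Suc j) else 0)"
    (is "?L = ?R")
proof (rule eq_matI)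
  fix i j assume "i < dim_row ?R" "j < dim_col ?R"
  then have ij: "i < Suc n" "j < Suc n" by simp_all
  have delta: "(\<Sum>k = 0..<Suc n. if k = Suc m then f k else 0) = (if m < n then f (Suc m) else 0)"
    for m and f :: "nat \<Rightarrow> complex"
    by simp
  have left: "(mat_adjoint (disp_F n t) * M) $$ (i, k) = (if i < n then M $$ (Suc i, k) else 0)"
    if "k < Suc n" for k
  proof -
    have "(mat_adjoint (disp_F n t) * M) $$ (i, k)
        = (\<Sum>l = 0..<Suc n. cnj (if l = Suc i then 1 else 0) * M $$ (l, k))"
      using ij that M by (simp add: mat_adjoint_eq disp_F_def scalar_prod_def)
    also have "\<dots> = (\<Sum>l = 0..<Suc n. if l = Suc i then M $$ (l, k) else 0)"
      by (intro sum.cong) auto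
    finally show ?thesis by (simp only: delta)
  qed
  have "?L $$ (i, j)
      = (\<Sum>k = 0..<Suc n. (mat_adjoint (disp_F n t) * M) $$ (i, k) * (if k = Suc j then 1 else 0))"
    using ij M by (simp add: mat_adjoint_eq disp_F_def scalar_prod_def)
  also have "\<dots> = (\<Sum>k = 0..<Suc n. if k = Suc j then (if i < n then M $$ (Suc i, k) else 0) else 0)"
    by (intro sum.cong) (auto simp: left)
  also have "\<dots> = (if j < n then (if i < n then M $$ (Suc i, Suc j) else 0) else 0)"
    by (rule delta)
  finally show "?L $$ (i, j) = ?R $$ (i, j)"
    using ij by simp
qed (use M in \<open>simp_all add: mat_adjoint_eq disp_F_def\<close>)

lemma signature_form:
  assumes H: "H \<in> carrier_mat 2 n"
  shows "mat_adjoint H * disp_J t * H =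
    mat n n (\<lambda>(i, j). cnj (H $$ (0, i)) * H $$ (0, j) - cnj (H $$ (1, i)) * H $$ (1, j))"
    (is "?L = ?R")
proof (rule eq_matI)
  fix i j assume "i < dim_row ?R" "j < dim_col ?R"
  then have ij: "i < n" "j < n" by simp_all
  have two: "{0..<2} = {0, 1 :: nat}" by auto
  have J: "disp_J t \<in> carrier_mat 2 2"
    "disp_J t $$ (0, 0) = 1" "disp_J t $$ (0, 1) = 0" "disp_J t $$ (1, 0) = 0" "disp_J t $$ (1, 1) = - 1"
    by (auto simp: disp_J_def mat_of_rows_list_def)
  have "(mat_adjoint H * disp_J t) $$ (i, k) = (\<Sum>l = 0..<2. cnj (H $$ (l, i)) * disp_J t $$ (l, k))"
    if "k < 2" for k
    using H J(1) ij that by (simp add: mat_adjoint_eq scalar_prod_def)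
  then have "(mat_adjoint H * disp_J t) $$ (i, 0) = cnj (H $$ (0, i))"
    "(mat_adjoint H * disp_J t) $$ (i, 1) = - cnj (H $$ (1, i))"
    unfolding two using J by simp_all
  moreover have "?L $$ (i, j) = (\<Sum>k = 0..<2. (mat_adjoint H * disp_J t) $$ (i, k) * H $$ (k, j))"
    using H J(1) ij by (simp add: mat_adjoint_eq scalar_prod_def)
  ultimately show "?L $$ (i, j) = ?R $$ (i, j)"
    unfolding two using ij by simp
qed (use H in \<open>simp_all add: mat_adjoint_eq disp_J_def mat_of_rows_list_def\<close>)

text \<open>This is invariance of the form of signature \<open>(1, -1)\<close> under one recursion
  step: mixed terms cancel and the common factor \<open>1 - g * cnj g\<close> is
  \<open>d * d\<close>.\<close>

lemma J_unitary:
  assumes "g * cnj g + d * d = 1" "d \<noteq> 0" "cnj d = d"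
  shows "((x - g * y) / d) * cnj ((x' - g * y') / d) - ((y - cnj g * x) / d) * cnj ((y' - cnj g * x') / d)
    = x * cnj x' - y * cnj y'"
proof -
  have "((x - g * y) / d) * cnj ((x' - g * y') / d) - ((y - cnj g * x) / d) * cnj ((y' - cnj g * x') / d)
    = (1 - g * cnj g) * (x * cnj x' - y * cnj y') / (d * d)"
    using assms(3) by (simp add: algebra_simps diff_divide_distrib [symmetric] add_divide_distrib [symmetric])
  also have "1 - g * cnj g = d * d"
    using assms(1) by (simp add: algebra_simps)
  finally show ?thesis using assms(2) by simp
qed

section \<open>The Christoffel-Darboux kernel and its displacement\<close>

context moment_kernel
begin

definition cd_kernel :: "nat \<Rightarrow> nat \<Rightarrow> nat \<Rightarrow> nat \<Rightarrow> complex" where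
  "cd_kernel n l i j = (\<Sum>a\<le>n. coeff (ophi s \<gamma> a l) i * cnj (coeff (ophi s \<gamma> a l) j))"

text \<open>The sum telescopes: \<open>J_unitary\<close> turns the term added to the left into the
  new summand at level \<open>Suc l\<close> plus the change of the sharp term. For
  \<open>n = 0\<close> only coefficients of constants at positive index occur.\<close>

lemma cd_kernel_shift:
  "cd_kernel n l (Suc i) (Suc j) =
    (\<Sum>a<n. coeff (ophi s \<gamma> a (Suc l)) i * cnj (coeff (ophi s \<gamma> a (Suc l)) j)) +
    coeff (ophi_sharp s \<gamma> n l) (Suc i) * cnj (coeff (ophi_sharp s \<gamma> n l) (Suc j))"
proof (induction n)
  case 0
  then show ?case by (simp add: cd_kernel_def)
next
  case (Suc n)
  define g where "g = \<gamma> l (Suc n + l)"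
  \<comment> \<open>Only the first polynomial of the recursion is multiplied by the variable, so
    \<open>\<alpha>\<close> is taken at \<open>i\<close> and \<open>\<beta>\<close> at
    \<open>Suc i\<close>.\<close>
  define \<alpha> where "\<alpha> = (\<lambda>i. coeff (ophi s \<gamma> n (Suc l)) i)"
  define \<beta> where "\<beta> = (\<lambda>i. coeff (ophi_sharp s \<gamma> n l) (Suc i))"
  have g: "cmod g < 1" using gamma_less [of l "Suc n"] by (simp add: g_def)
  have x: "coeff (ophi s \<gamma> (Suc n) l) (Suc i) = (\<alpha> i - g * \<beta> i) / defect g"
    and y: "coeff (ophi_sharp s \<gamma> (Suc n) l) (Suc i) = (\<beta> i - cnj g * \<alpha> i) / defect g" for i
    by (simp_all add: \<alpha>_def \<beta>_def g_def divide_simps)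
  have "cd_kernel (Suc n) l (Suc i) (Suc j) = cd_kernel n l (Suc i) (Suc j) +
      coeff (ophi s \<gamma> (Suc n) l) (Suc i) * cnj (coeff (ophi s \<gamma> (Suc n) l) (Suc j))"
    by (simp add: cd_kernel_def)
  also have "coeff (ophi s \<gamma> (Suc n) l) (Suc i) * cnj (coeff (ophi s \<gamma> (Suc n) l) (Suc j)) =
      \<alpha> i * cnj (\<alpha> j) - \<beta> i * cnj (\<beta> j) +
      coeff (ophi_sharp s \<gamma> (Suc n) l) (Suc i) * cnj (coeff (ophi_sharp s \<gamma> (Suc n) l) (Suc j))"
    unfolding x y using J_unitary [of g "defect g" "\<alpha> i" "\<beta> i" "\<alpha> j" "\<beta> j"]
    by (simp add: defect_square g defect_nonzero diff_eq_eq)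
  finally show ?case
    unfolding Suc.IH by (simp add: \<alpha>_def \<beta>_def)
qed

lemma coeff_ophi_eq_0:
  "n < i \<Longrightarrow> coeff (ophi s \<gamma> n l) i = 0" "n < i \<Longrightarrow> coeff (ophi_sharp s \<gamma> n l) i = 0"
  using degree_ophi [of n l] by (simp_all add: coeff_eq_0)

lemma cd_kernel_displacement:
  "cd_kernel n (Suc l) i j - (if i < n \<and> j < n then cd_kernel n l (Suc i) (Suc j) else 0) =
    coeff (ophi s \<gamma> n (Suc l)) i * cnj (coeff (ophi s \<gamma> n (Suc l)) j) -
    coeff (ophi_sharp s \<gamma> n l) (Suc i) * cnj (coeff (ophi_sharp s \<gamma> n l) (Suc j))"
proof -
  have "cd_kernel n l (Suc i) (Suc j) = 0" if "\<not> (i < n \<and> j < n)"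
    using that by (auto simp: cd_kernel_def coeff_ophi_eq_0 intro!: sum.neutral)
  then have "(if i < n \<and> j < n then cd_kernel n l (Suc i) (Suc j) else 0) = cd_kernel n l (Suc i) (Suc j)"
    by simp
  then show ?thesis
    by (simp add: cd_kernel_shift) (simp add: cd_kernel_def flip: lessThan_Suc_atMost)
qed

text \<open>Orthonormality reads \<open>?B * (?R * ?A) = 1\<close>, with coefficient vectors as
  columns of \<open>?A\<close> and \<open>?B\<close> its adjoint. One-sided inverses of square
  matrices are two-sided, so \<open>?A\<close> may move to the front, and \<open>?A * ?B\<close> is
  the kernel.\<close>

lemma
  shows invertible_disp_R: "invertible_mat (disp_R s n t)"
    and minv_disp_R: "minv (disp_R s n t) = mat (n + 1) (n + 1) (\<lambda>(i, j). cd_kernel n t i j)"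
proof -
  let ?R = "disp_R s n t"
  let ?A = "mat (n + 1) (n + 1) (\<lambda>(i, a). coeff (ophi s \<gamma> a t) i)"
  let ?B = "mat (n + 1) (n + 1) (\<lambda>(a, i). cnj (coeff (ophi s \<gamma> a t) i))"
  have R: "?R \<in> carrier_mat (n + 1) (n + 1)" by (simp add: disp_R_def)
  have "?B * (?R * ?A) = 1\<^sub>m (n + 1)"
  proof (rule eq_matI)
    fix b a assume "b < dim_row (1\<^sub>m (n + 1))" "a < dim_col (1\<^sub>m (n + 1))"
    then have ba: "a \<le> n" "b \<le> n" by auto
    have "(?B * (?R * ?A)) $$ (b, a) = (\<Sum>k\<le>n. cnj (coeff (ophi s \<gamma> b t) k) *
        (\<Sum>j\<le>n. s (t + k) (t + j) * coeff (ophi s \<gamma> a t) j))"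
      using ba by (simp add: scalar_prod_def disp_R_def atLeast0LessThan lessThan_Suc_atMost del: sum.lessThan_Suc)
    also have "\<dots> = ip (Phi t a) (Phi t b)"
      by (simp add: ip_Phi(1) [OF ba(2)] Phi_as_sum(1) [OF ba(1)] ip_sum ip_smult moments mult.commute)
    finally show "(?B * (?R * ?A)) $$ (b, a) = 1\<^sub>m (n + 1) $$ (b, a)"
      using ba by (simp add: ophi_orthonormal)
  qed (simp_all add: disp_R_def)
  then have "(?B * ?R) * ?A = 1\<^sub>m (n + 1)"
    using R by (subst assoc_mult_mat [of _ "n + 1" "n + 1" _ "n + 1" _ "n + 1"]) auto
  then have "?A * (?B * ?R) = 1\<^sub>m (n + 1)"
    using R by (intro mat_mult_left_right_inverse [of "?B * ?R" "n + 1" ?A]) auto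
  then have "(?A * ?B) * ?R = 1\<^sub>m (n + 1)"
    using R by (subst assoc_mult_mat [of _ "n + 1" "n + 1" _ "n + 1" _ "n + 1"]) auto
  moreover have "?A * ?B = mat (n + 1) (n + 1) (\<lambda>(i, j). cd_kernel n t i j)"
    by (rule eq_matI) (simp_all add: scalar_prod_def cd_kernel_def atLeast0LessThan lessThan_Suc_atMost del: sum.lessThan_Suc)
  ultimately show "invertible_mat ?R" "minv ?R = mat (n + 1) (n + 1) (\<lambda>(i, j). cd_kernel n t i j)"
    using minv_eqI [OF R, of "?A * ?B"] by auto
qed

lemma cnj_ophi_lead: "cnj (coeff (ophi s \<gamma> n l) n) = coeff (ophi s \<gamma> n l) n"
  using ophi_lead [of n l] by auto

lemma displacement_equation:
  "minv (disp_R s n (t + 1)) - mat_adjoint (disp_F n t) * minv (disp_R s n t) * disp_F n t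
    = mat_adjoint (disp_H s \<gamma> n t) * disp_J t * disp_H s \<gamma> n t"
proof -
  let ?H = "disp_H s \<gamma> n t"
  have H: "?H \<in> carrier_mat 2 (n + 1)"
    by (simp add: disp_H_def)
  \<comment> \<open>The last entry of this row of \<open>disp_H\<close> is unconjugated; being a
    real leading coefficient it fits the same formula.\<close>
  have H0: "?H $$ (0, j) = cnj (coeff (ophi s \<gamma> n (t + 1)) j)" if "j < n + 1" for j
    using that by (auto simp: disp_H_def cnj_ophi_lead less_Suc_eq)
  \<comment> \<open>The corner zero is coefficient \<open>n + 1\<close> of a polynomial of degree at
    most \<open>n\<close>.\<close>
  have H1: "?H $$ (1, j) = cnj (coeff (ophi_sharp s \<gamma> n t) (Suc j))" if "j < n + 1" for j
    using that by (auto simp: disp_H_def coeff_ophi_eq_0 less_Suc_eq)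
  have C: "mat (n + 1) (n + 1) (\<lambda>(i, j). cd_kernel n t i j) \<in> carrier_mat (n + 1) (n + 1)"
    by simp
  show ?thesis (is "?L = ?R")
  proof (rule eq_matI)
    fix i j
    assume "i < dim_row ?R" "j < dim_col ?R"
    then have "i < n + 1" "j < n + 1"
      using H by (simp_all add: mat_adjoint_eq)
    then show "?L $$ (i, j) = ?R $$ (i, j)"
      unfolding minv_disp_R disp_F_compress [OF C] signature_form [OF H]
      using cd_kernel_displacement [of n t i j]
      by (cases "i < n \<and> j < n") (auto simp: H0 H1 [simplified])
  qed (use H in \<open>simp_all add: mat_adjoint_eq disp_F_def minv_disp_R\<close>)
qed

end

text \<open>The equation determines \<open>Y (t + 1)\<close> from \<open>Y t\<close>. This is the
  sense in which the inverses are the solution: the one with their initial value.\<close>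

lemma displacement_unique:
  fixes Y Z F :: "nat \<Rightarrow> complex mat"
  assumes carrier: "\<And>t. Y t \<in> carrier_mat m m" "\<And>t. Z t \<in> carrier_mat m m" "\<And>t. F t \<in> carrier_mat m m"
    and "Y 0 = Z 0"
    and eq: "\<And>t. Y (t + 1) - mat_adjoint (F t) * Y t * F t = Z (t + 1) - mat_adjoint (F t) * Z t * F t"
  shows "Y t = Z t"
proof (induction t)
  case (Suc t)
  let ?S = "mat_adjoint (F t) * Y t * F t"
  have "?S \<in> carrier_mat m m"
    using carrier [of t] by (auto simp: mat_adjoint_eq)
  then have "Y (Suc t) = (Y (t + 1) - ?S) + ?S" "Z (Suc t) = (Z (t + 1) - ?S) + ?S"
    using carrier [of "Suc t"] by (auto intro!: eq_matI)
  then show ?case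
    using eq [of t] Suc.IH by simp
qed (fact assms)

section \<open>From the functional on the free algebra to the inner product\<close>

lemma nc_of_poly_extend:
  assumes "degree p \<le> n"
  shows "nc_of_poly p = (\<Sum>i\<le>n. ncconst (coeff p i) * ncX1 ^ i)"
  unfolding nc_of_poly_def using assms
  by (intro sum.mono_neutral_left) (auto simp: coeff_eq_0 ncconst_def)

lemma nc_of_poly_add: "nc_of_poly (p + q) = nc_of_poly p + nc_of_poly q"
proof -
  let ?n = "max (degree p) (degree q)"
  have "degree (p + q) \<le> ?n" by (rule degree_add_le_max)
  then show ?thesis
    by (simp add: nc_of_poly_extend [of _ ?n] ncconst_def single_add distrib_right sum.distrib)
qed

lemma nc_of_poly_smult: "nc_of_poly (smult c p) = nc_scale c (nc_of_poly p)"
  by (simp add: nc_of_poly_extend [of _ "degree p"] degree_smult_le nc_scale_def ncconst_def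
      sum_distrib_left mult_single flip: mult.assoc)

lemma nc_of_poly_monom: "nc_of_poly (monom 1 k) = ncX1 ^ k"
proof -
  have "nc_of_poly (monom 1 k) = (\<Sum>i\<le>k. if i = k then ncX1 ^ i else 0)"
    unfolding nc_of_poly_extend [OF degree_monom_le]
    by (rule sum.cong) (auto simp: ncconst_def)
  then show ?thesis by simp
qed

text \<open>Hermitian symmetry is not assumed of \<open>\<phi>\<close>; it follows by polarisation,
  since positivity makes every \<open>ip p p\<close> real.\<close>

lemma moment_kernel_moment:
  assumes lin: "Vector_Spaces.linear nc_scale (*) \<phi>" and pos: "strictly_q_positive \<phi>"
    and par: "kernel_parameters (moment \<phi>) \<gamma>"
  shows "moment_kernel (\<lambda>p q. \<phi> (nc_star (nc_of_poly q) * nc_of_poly p)) (moment \<phi>) \<gamma>"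
proof -
  interpret Vector_Spaces.linear nc_scale "(*)" \<phi> by (fact lin)
  define ip where "ip = (\<lambda>p q. \<phi> (nc_star (nc_of_poly q) * nc_of_poly p))"
  \<comment> \<open>The exponent of a constant is the empty word, so a scalar can be moved past the
    starred left factor.\<close>
  have central: "ncconst c * P = P * ncconst c" for c P
    unfolding ncconst_def
    by (subst (1 2) poly_mapping_as_sum_single [of P])
      (simp add: sum_distrib_left sum_distrib_right mult_single mult.commute)
  have add: "ip (p + q) r = ip p r + ip q r" "ip r (p + q) = ip r p + ip r q" for p q r
    by (simp_all add: ip_def nc_of_poly_add nc_star_add distrib_left distrib_right add)
  have scale_left: "ip (smult c p) r = c * ip p r" for c p r
  proof -
    have "nc_star (nc_of_poly r) * nc_of_poly (smult c p) =
        nc_scale c (nc_star (nc_of_poly r) * nc_of_poly p)"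
      by (metis nc_of_poly_smult nc_scale_def central mult.assoc)
    then show ?thesis by (simp add: ip_def scale)
  qed
  have scale_right: "ip r (smult c p) = cnj c * ip r p" for c p r
  proof -
    have "nc_star (nc_of_poly (smult c p)) * nc_of_poly r =
        nc_scale (cnj c) (nc_star (nc_of_poly p) * nc_of_poly r)"
      by (simp only: nc_of_poly_smult nc_star_scale) (simp only: nc_scale_def mult.assoc)
    then show ?thesis by (simp add: ip_def scale)
  qed
  have pos': "p \<noteq> 0 \<Longrightarrow> 0 < ip p p" for p
    using pos by (simp add: ip_def strictly_q_positive_def)
  have real: "Im (ip p p) = 0" for p
    using pos' [of p] scale_left [of 0 0 0] by (cases "p = 0") (auto simp: less_complex_def)
  \<comment> \<open>Realness at \<open>p + q\<close> makes the imaginary parts of the two cross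
    terms opposite; realness at \<open>p + smult \<i> q\<close> makes their real parts
    equal.\<close>
  have "Im (ip p q + ip q p) = 0" for p q
    using real [of "p + q"] real [of p] real [of q] by (simp add: add)
  moreover have "Im (ip p (smult \<i> q) + ip (smult \<i> q) p) = 0" for p q
    using real [of "p + smult \<i> q"] real [of p] real [of "smult \<i> q"] by (simp add: add)
  ultimately have herm: "ip q p = cnj (ip p q)" for p q
    by (simp add: complex_eq_iff scale_left scale_right) (metis add_eq_0_iff add.commute)
  show ?thesis
    unfolding ip_def [symmetric]
    by (intro moment_kernel.intro add scale_left herm pos' par)
      (simp_all add: ip_def moment_def nc_of_poly_monom)
qed

theorem theorem2p4:
  fixes \<phi> :: "ncpoly \<Rightarrow> complex" and \<gamma> s :: "nat \<Rightarrow> nat \<Rightarrow> complex"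
  assumes "Vector_Spaces.linear nc_scale (*) \<phi>"
    and "strictly_q_positive \<phi>"
    and "s = moment \<phi>"
    and "kernel_parameters s \<gamma>"
  shows "\<forall>n.
    (\<forall>t. invertible_mat (disp_R s n t)) \<and>
    (\<forall>t. minv (disp_R s n (t + 1))
           - mat_adjoint (disp_F n t) * minv (disp_R s n t) * disp_F n t
         = mat_adjoint (disp_H s \<gamma> n t) * disp_J t * disp_H s \<gamma> n t) \<and>
    (\<forall>Y :: nat \<Rightarrow> complex mat.
       (\<forall>t. Y t \<in> carrier_mat (n + 1) (n + 1)) \<longrightarrow>
       Y 0 = minv (disp_R s n 0) \<longrightarrow>
       (\<forall>t. Y (t + 1) - mat_adjoint (disp_F n t) * Y t * disp_F n t
            = mat_adjoint (disp_H s \<gamma> n t) * disp_J t * disp_H s \<gamma> n t) \<longrightarrow>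
       (\<forall>t. Y t = minv (disp_R s n t)))"
proof -
  interpret moment_kernel "\<lambda>p q. \<phi> (nc_star (nc_of_poly q) * nc_of_poly p)" s \<gamma>
    unfolding \<open>s = moment \<phi>\<close>
    by (rule moment_kernel_moment [OF assms(1,2)]) (use assms(3,4) in simp)
  show ?thesis
  proof (intro allI conjI impI)
    fix n t and Y :: "nat \<Rightarrow> complex mat"
    assume "\<forall>t. Y t \<in> carrier_mat (n + 1) (n + 1)" "Y 0 = minv (disp_R s n 0)"
      "\<forall>t. Y (t + 1) - mat_adjoint (disp_F n t) * Y t * disp_F n t
        = mat_adjoint (disp_H s \<gamma> n t) * disp_J t * disp_H s \<gamma> n t"
    then show "Y t = minv (disp_R s n t)"
      by - (rule displacement_unique [of Y "n + 1" "\<lambda>t. minv (disp_R s n t)" "disp_F n"],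
          simp_all only: displacement_equation, simp_all add: minv_disp_R disp_F_def)
  qed (rule invertible_disp_R displacement_equation)+
qed

end
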